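(* Let $\Theta\subseteq\mathbb{R}^p$ be a parameter set, let $\tilde\Theta\subset\Theta$, and let $x_1,x_2,\ldots$ be random observations in a space $\mathcal{X}$ whose joint distribution $P$ is the one belonging to the true parameter $\theta_0$. For each $n\in\mathbb{N}$ let $h_n(x_1,\ldots,x_n;\theta)$ be a real-valued function of the observations and of $\theta\in\Theta$, and define the unconstrained and constrained estimators $$T_n=\arg\max_{\theta\in\Theta}h_n(x_1,\ldots,x_n;\theta),\qquad \tilde T_n=\arg\max_{\theta\in\tilde\Theta}h_n(x_1,\ldots,x_n;\theta),$$ where each estimator may take any value whenever the corresponding argmax does not exist or is not unique. Assume that $\theta_0\in\tilde\Theta^o$, the interior of $\tilde\Theta$. Consider the following properties of a sequence of estimators $(S_n)_{n\in\mathbb{N}}$ defined by such an argmax: (C1) The probability that the argmax in the definition of $S_n$ exists and is unique converges to $1$ as $n\to\infty$. (C2) $S_n$ is weakly consistent: for all $\epsilon>0$, $P\{\|S_n-\theta_0\|<\epsilon\}\to 1$ as $n\to\infty$. (C3) For given functions $G_n$ and a given distribution $Q$, $G_n(S_n;\theta_0)$ converges in distribution to $Q$ as $n\to\infty$. Then: (a) If $(T_n)$ fulfills (C1) and (C2), then $(\tilde T_n)$ fulfills (C1) and (C2) (with the argmax taken over $\tilde\Theta$), and $$\lim_{n\to\infty}P\{T_n=\tilde T_n\}=1.$$ (b) If $(T_n)$ fulfills (C1), (C2) and (C3), then $(\tilde T_n)$ also fulfills (C3), with the same functions $G_n$ and the same distribution $Q$.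
   Context: The interior $S^o$ of a set $S\subseteq\mathbb{R}^p$ is its topological interior in $\mathbb{R}^p$, and $\|\cdot\|$ is the Euclidean norm on $\mathbb{R}^p$. The estimators $T_n,\tilde T_n$ are $\mathbb{R}^p$-valued functions of $(x_1,\ldots,x_n)$. "The argmax exists and is unique" means that there is exactly one point of the set over which one maximizes at which $h_n(x_1,\ldots,x_n;\cdot)$ attains its maximum over that set; in that case the estimator equals this point. The values of $T_n$ and $\tilde T_n$ in the remaining cases are arbitrary (and need not be related to each other). In (C3), $G_n(\cdot;\theta_0)$ is a function defined on the possible values of the estimators with values in $\mathbb{R}^d$ for some fixed $d\geq 1$, and $Q$ is a probability distribution on $\mathbb{R}^d$; convergence in distribution is the usual weak convergence of the laws. All events and maps whose probabilities or distributions are considered are assumed measurable. *)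

theory Defs
  imports "HOL-Probability.Probability"
begin

definition unique_argmax :: "('b \<Rightarrow> real) \<Rightarrow> 'b set \<Rightarrow> bool" where
  "unique_argmax f S \<longleftrightarrow> (\<exists>!t. is_arg_max f (\<lambda>s. s \<in> S) t)"

(* The data (x_1, ..., x_n), a point of the product space PiM {1..n} (\<lambda>_. X). *)
definition obs :: "(nat \<Rightarrow> 'w \<Rightarrow> 'x) \<Rightarrow> nat \<Rightarrow> 'w \<Rightarrow> nat \<Rightarrow> 'x" where
  "obs x n w = (\<lambda>i\<in>{1..n}. x i w)"

(* T n is a function of the data that equals the argmax of h n over S whenever that argmax
   exists and is unique. Its values for all other data are arbitrary and may lie outside S. *)
definition argmax_estimator ::
  "'x measure \<Rightarrow> (nat \<Rightarrow> (nat \<Rightarrow> 'x) \<Rightarrow> 'b \<Rightarrow> real) \<Rightarrow> 'b set \<Rightarrow> (nat \<Rightarrow> (nat \<Rightarrow> 'x) \<Rightarrow> 'b) \<Rightarrow> bool"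
  where
  "argmax_estimator X h S T \<longleftrightarrow>
     (\<forall>n\<ge>1. \<forall>xs\<in>space (PiM {1..n} (\<lambda>_. X)).
        unique_argmax (h n xs) S \<longrightarrow> is_arg_max (h n xs) (\<lambda>s. s \<in> S) (T n xs))"

definition argmax_exists_asymptotically ::
  "'w measure \<Rightarrow> (nat \<Rightarrow> 'w \<Rightarrow> 'x) \<Rightarrow> (nat \<Rightarrow> (nat \<Rightarrow> 'x) \<Rightarrow> 'b \<Rightarrow> real) \<Rightarrow> 'b set \<Rightarrow> bool" where
  "argmax_exists_asymptotically M x h S \<longleftrightarrow>
     (\<lambda>n. \<P>(w in M. unique_argmax (h n (obs x n w)) S)) \<longlonglongrightarrow> 1"

definition weakly_consistent ::
  "'w measure \<Rightarrow> (nat \<Rightarrow> 'w \<Rightarrow> 'x) \<Rightarrow> (nat \<Rightarrow> (nat \<Rightarrow> 'x) \<Rightarrow> 'b::real_normed_vector) \<Rightarrow> 'b \<Rightarrow> bool"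
  where
  "weakly_consistent M x S \<theta>\<^sub>0 \<longleftrightarrow>
     (\<forall>\<epsilon>>0. (\<lambda>n. \<P>(w in M. norm (S n (obs x n w) - \<theta>\<^sub>0) < \<epsilon>)) \<longlonglongrightarrow> 1)"

(* The library's weak_conv_m covers only measures on the real line. *)
definition weak_conv_measures ::
  "(nat \<Rightarrow> 'b::topological_space measure) \<Rightarrow> 'b measure \<Rightarrow> bool" where
  "weak_conv_measures \<mu> Q \<longleftrightarrow>
     (\<forall>f::'b \<Rightarrow> real. continuous_on UNIV f \<and> bounded (range f) \<longrightarrow>
        (\<lambda>n. \<integral>y. f y \<partial>\<mu> n) \<longlonglongrightarrow> (\<integral>y. f y \<partial>Q))"

definition converges_in_distribution ::
  "'w measure \<Rightarrow> (nat \<Rightarrow> 'w \<Rightarrow> 'b::topological_space) \<Rightarrow> 'b measure \<Rightarrow> bool" where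
  "converges_in_distribution M Y Q \<longleftrightarrow> weak_conv_measures (\<lambda>n. distr M borel (Y n)) Q"

end

theory Submission imports Defs begin

text \<open>
  If the unconstrained argmax exists, is unique and lies in the constraint set, then it is also the
  unique constrained argmax, so both estimators agree. By consistency the unconstrained argmax lies in
  a ball around the true parameter that is contained in the constraint set, with probability tending
  to 1. Everything else follows because the two estimators agree on events of probability tending to 1.
\<close>

lemma is_arg_max_subset:
  fixes f :: "'b \<Rightarrow> real"
  assumes "is_arg_max f (\<lambda>s. s \<in> S) t" "t \<in> S'" "S' \<subseteq> S"
  shows "is_arg_max f (\<lambda>s. s \<in> S') t"
  using assms unfolding is_arg_max_def by blast

text \<open>Any maximiser \<open>u\<close> over \<open>S'\<close> has the same value as
  \<open>t\<close>, because \<open>t\<close> itself lies in \<open>S'\<close>. Hence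
  \<open>u\<close> already attains the maximum over the larger set \<open>S\<close>, and uniqueness
  there forces \<open>u = t\<close>.\<close>

lemma unique_argmax_subset:
  assumes unique: "unique_argmax f S" and t: "is_arg_max f (\<lambda>s. s \<in> S) t"
    and S': "t \<in> S'" "S' \<subseteq> S"
  shows "unique_argmax f S'"
  unfolding unique_argmax_def
proof (rule ex1I)
  show t': "is_arg_max f (\<lambda>s. s \<in> S') t"
    using t S' by (rule is_arg_max_subset)
  fix u assume u: "is_arg_max f (\<lambda>s. s \<in> S') u"
  have "f u = f t"
    using u t' by (force simp: is_arg_max_linorder)
  then have "is_arg_max f (\<lambda>s. s \<in> S) u"
    using t u S' by (auto simp: is_arg_max_def)
  then show "u = t"
    using unique t unfolding unique_argmax_def by blast
qed

lemma argmax_estimator_eq: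
  assumes "argmax_estimator X h S T" "n \<ge> 1" "xs \<in> space (PiM {1..n} (\<lambda>_. X))"
    and "unique_argmax (h n xs) S" "is_arg_max (h n xs) (\<lambda>s. s \<in> S) t"
  shows "T n xs = t"
  using assms unfolding argmax_estimator_def unique_argmax_def by blast

text \<open>The pointwise core, free of probability. Uniqueness over \<open>S\<close> pins
  \<open>T n xs\<close> to the true maximiser; since this point survives in \<open>S'\<close>, it is
  also the only maximiser there, and \<open>T'\<close> has no choice but to return it.\<close>

lemma argmax_estimators_agree:
  assumes "argmax_estimator X h S T" "argmax_estimator X h S' T'"
    and n: "n \<ge> 1" "xs \<in> space (PiM {1..n} (\<lambda>_. X))"
    and unique: "unique_argmax (h n xs) S" and S': "T n xs \<in> S'" "S' \<subseteq> S"
  shows "unique_argmax (h n xs) S' \<and> T n xs = T' n xs"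
proof -
  have t: "is_arg_max (h n xs) (\<lambda>s. s \<in> S) (T n xs)"
    using assms(1) n unique by (auto simp: argmax_estimator_def)
  have "unique_argmax (h n xs) S'"
    using unique_argmax_subset[OF unique t S'] .
  then show ?thesis
    using argmax_estimator_eq[OF assms(2) n] is_arg_max_subset[OF t S'] by metis
qed

text \<open>The restriction to \<open>{1..n}\<close> in \<open>obs\<close> provides the
  extensionality that membership in the product space demands.\<close>

lemma obs_in_space_PiM:
  assumes "\<And>i. i \<ge> 1 \<Longrightarrow> x i \<in> M \<rightarrow>\<^sub>M X" "w \<in> space M"
  shows "obs x n w \<in> space (PiM {1..n} (\<lambda>_. X))"
  using measurable_space[OF assms(1) assms(2)] by (auto simp: obs_def space_PiM)

context prob_space
begin

text \<open>Sandwich between \<open>prob (A n)\<close> and 1. The inclusion is required only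
  eventually, since the estimators and their events are controlled only from \<open>n = 1\<close>
  on.\<close>

lemma prob_tendsto_1_mono:
  assumes "(\<lambda>n. prob (A n)) \<longlonglongrightarrow> 1"
    and "\<forall>\<^sub>F n in sequentially. A n \<subseteq> B n \<and> B n \<in> events"
  shows "(\<lambda>n. prob (B n)) \<longlonglongrightarrow> 1"
proof (rule tendsto_sandwich[OF _ _ assms(1) tendsto_const])
  show "\<forall>\<^sub>F n in sequentially. prob (A n) \<le> prob (B n)"
    using assms(2) by eventually_elim (auto intro: finite_measure_mono)
qed simp

text \<open>The lower bound in the sandwich is the Bonferroni inequality, which follows from
  inclusion-exclusion and \<open>prob (A n \<union> B n) \<le> 1\<close>.\<close>

lemma prob_tendsto_1_Int:
  assumes "(\<lambda>n. prob (A n)) \<longlonglongrightarrow> 1" "(\<lambda>n. prob (B n)) \<longlonglongrightarrow> 1"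
    and "\<forall>\<^sub>F n in sequentially. A n \<in> events \<and> B n \<in> events"
  shows "(\<lambda>n. prob (A n \<inter> B n)) \<longlonglongrightarrow> 1"
proof (rule tendsto_sandwich)
  show "(\<lambda>n. prob (A n) + prob (B n) - 1) \<longlonglongrightarrow> 1"
    using tendsto_diff[OF tendsto_add[OF assms(1,2)] tendsto_const[of 1]] by simp
  show "\<forall>\<^sub>F n in sequentially. prob (A n) + prob (B n) - 1 \<le> prob (A n \<inter> B n)"
    using assms(3)
  proof eventually_elim
    case (elim n)
    then have "prob (A n \<union> B n) = prob (A n) + prob (B n) - prob (A n \<inter> B n)"
      by (intro measure_Un3) (auto simp: fmeasurable_eq_sets)
    then show ?case
      using prob_le_1[of "A n \<union> B n"] by linarith
  qed
qed (auto intro: tendsto_const)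

text \<open>The integrands cancel on \<open>E\<close>, and off \<open>E\<close> they differ by at
  most \<open>2 * B\<close>, so the difference is dominated by a multiple of the indicator of the
  complement.\<close>

lemma expectation_diff_le:
  fixes f g :: "'a \<Rightarrow> real"
  assumes "f \<in> borel_measurable M" "g \<in> borel_measurable M"
    and bound: "\<And>w. \<bar>f w\<bar> \<le> B" "\<And>w. \<bar>g w\<bar> \<le> B"
    and E: "E \<in> events" and eq: "\<And>w. w \<in> E \<Longrightarrow> f w = g w"
  shows "\<bar>expectation f - expectation g\<bar> \<le> 2 * B * (1 - prob E)"
proof -
  have int: "integrable M f" "integrable M g"
    using assms by (auto intro!: integrable_const_bound[of _ B])
  have "\<bar>f w - g w\<bar> \<le> 2 * B * indicator (space M - E) w" if "w \<in> space M" for w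
    using that eq[of w] bound[of w] by (auto simp: indicator_def)
  then have "expectation (\<lambda>w. \<bar>f w - g w\<bar>) \<le> expectation (\<lambda>w. 2 * B * indicator (space M - E) w)"
    using int E by (intro integral_mono integrable_mult_right integrable_real_indicator)
      (auto simp: emeasure_eq_measure)
  also have "\<dots> = 2 * B * (1 - prob E)"
    using E by (simp add: prob_compl)
  finally show ?thesis
    using integral_abs_bound[of M "\<lambda>w. f w - g w"] int by simp
qed

text \<open>A coupling argument: for each bounded continuous test function, the integrals against
  the laws of \<open>Y n\<close> and \<open>Z n\<close> differ by at most a constant times the
  probability of the complement of \<open>E n\<close>. No distance between \<open>Y n\<close> and
  \<open>Z n\<close> enters, so an arbitrary topological space can serve as codomain.\<close>

lemma converges_in_distribution_eq:
  fixes Y Z :: "nat \<Rightarrow> 'a \<Rightarrow> 'b::topological_space"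
  assumes Y: "converges_in_distribution M Y Q"
    and meas: "\<forall>\<^sub>F n in sequentially. Y n \<in> borel_measurable M \<and> Z n \<in> borel_measurable M"
    and E: "\<forall>\<^sub>F n in sequentially. E n \<in> events \<and> (\<forall>w\<in>E n. Y n w = Z n w)"
    and lim: "(\<lambda>n. prob (E n)) \<longlonglongrightarrow> 1"
  shows "converges_in_distribution M Z Q"
  unfolding converges_in_distribution_def weak_conv_measures_def
proof (intro allI impI, elim conjE)
  fix f :: "'b \<Rightarrow> real"
  assume f: "continuous_on UNIV f" "bounded (range f)"
  then obtain B where B: "\<And>y. \<bar>f y\<bar> \<le> B"
    by (auto simp: bounded_iff)
  have f_meas: "f \<in> borel_measurable borel"
    using f(1) by (rule borel_measurable_continuous_onI)
  have "(\<lambda>n. (\<integral>y. f y \<partial>distr M borel (Z n)) - (\<integral>y. f y \<partial>distr M borel (Y n))) \<longlonglongrightarrow> 0"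
  proof (rule Lim_null_comparison)
    show "(\<lambda>n. 2 * B * (1 - prob (E n))) \<longlonglongrightarrow> 0"
      by (rule tendsto_eq_intros lim refl | simp)+
    show "\<forall>\<^sub>F n in sequentially. norm ((\<integral>y. f y \<partial>distr M borel (Z n)) -
        (\<integral>y. f y \<partial>distr M borel (Y n))) \<le> 2 * B * (1 - prob (E n))"
      using meas E
    proof eventually_elim
      case (elim n)
      \<comment> \<open>Pulled back to the sample space by \<open>integral_distr\<close>, the two
        integrals become expectations of functions that can be compared point by point on
        \<open>E n\<close>.\<close>
      then have "\<bar>expectation (\<lambda>w. f (Z n w)) - expectation (\<lambda>w. f (Y n w))\<bar> \<le> 2 * B * (1 - prob (E n))"
        using B f_meas by (intro expectation_diff_le) (auto intro: measurable_compose)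
      then show ?case
        using elim f_meas by (simp add: integral_distr)
    qed
  qed
  moreover have "(\<lambda>n. \<integral>y. f y \<partial>distr M borel (Y n)) \<longlonglongrightarrow> (\<integral>y. f y \<partial>Q)"
    using Y f unfolding converges_in_distribution_def weak_conv_measures_def by blast
  ultimately show "(\<lambda>n. \<integral>y. f y \<partial>distr M borel (Z n)) \<longlonglongrightarrow> (\<integral>y. f y \<partial>Q)"
    by (rule Lim_transform[rotated])
qed

end

theorem theorem1:
  fixes \<Theta> \<Theta>' :: "(real ^ 'p) set"
    and \<theta>\<^sub>0 :: "real ^ 'p"
    and X :: "'x measure"
    and P :: "real ^ 'p \<Rightarrow> 'w measure"
    and x :: "nat \<Rightarrow> 'w \<Rightarrow> 'x"
    and h :: "nat \<Rightarrow> (nat \<Rightarrow> 'x) \<Rightarrow> real ^ 'p \<Rightarrow> real"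
    and T T' :: "nat \<Rightarrow> (nat \<Rightarrow> 'x) \<Rightarrow> real ^ 'p"
    and G :: "nat \<Rightarrow> real ^ 'p \<Rightarrow> real ^ 'p \<Rightarrow> real ^ 'd"
    and Q :: "(real ^ 'd) measure"
  assumes "\<Theta>' \<subseteq> \<Theta>"
    and "\<theta>\<^sub>0 \<in> interior \<Theta>'"
    and "\<And>\<theta>. \<theta> \<in> \<Theta> \<Longrightarrow> prob_space (P \<theta>)"
    and "\<And>\<theta> i. \<theta> \<in> \<Theta> \<Longrightarrow> i \<ge> 1 \<Longrightarrow> x i \<in> P \<theta> \<rightarrow>\<^sub>M X"
    and "argmax_estimator X h \<Theta> T"
    and "argmax_estimator X h \<Theta>' T'"
    and "\<And>n. n \<ge> 1 \<Longrightarrow>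
           {w \<in> space (P \<theta>\<^sub>0). unique_argmax (h n (obs x n w)) \<Theta>} \<in> sets (P \<theta>\<^sub>0)"
    and "\<And>n. n \<ge> 1 \<Longrightarrow>
           {w \<in> space (P \<theta>\<^sub>0). unique_argmax (h n (obs x n w)) \<Theta>'} \<in> sets (P \<theta>\<^sub>0)"
    and "\<And>n \<epsilon>. n \<ge> 1 \<Longrightarrow> \<epsilon> > 0 \<Longrightarrow>
           {w \<in> space (P \<theta>\<^sub>0). norm (T n (obs x n w) - \<theta>\<^sub>0) < \<epsilon>} \<in> sets (P \<theta>\<^sub>0)"
    and "\<And>n \<epsilon>. n \<ge> 1 \<Longrightarrow> \<epsilon> > 0 \<Longrightarrow>
           {w \<in> space (P \<theta>\<^sub>0). norm (T' n (obs x n w) - \<theta>\<^sub>0) < \<epsilon>} \<in> sets (P \<theta>\<^sub>0)"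
    and "\<And>n. n \<ge> 1 \<Longrightarrow>
           {w \<in> space (P \<theta>\<^sub>0). T n (obs x n w) = T' n (obs x n w)} \<in> sets (P \<theta>\<^sub>0)"
  shows
    "(argmax_exists_asymptotically (P \<theta>\<^sub>0) x h \<Theta> \<and> weakly_consistent (P \<theta>\<^sub>0) x T \<theta>\<^sub>0 \<longrightarrow>
        argmax_exists_asymptotically (P \<theta>\<^sub>0) x h \<Theta>' \<and> weakly_consistent (P \<theta>\<^sub>0) x T' \<theta>\<^sub>0 \<and>
        (\<lambda>n. \<P>(w in P \<theta>\<^sub>0. T n (obs x n w) = T' n (obs x n w))) \<longlonglongrightarrow> 1)
     \<and>
     (prob_space Q \<and> sets Q = sets borel \<and>
      (\<forall>n\<ge>1. (\<lambda>w. G n (T n (obs x n w)) \<theta>\<^sub>0) \<in> borel_measurable (P \<theta>\<^sub>0)) \<and>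
      (\<forall>n\<ge>1. (\<lambda>w. G n (T' n (obs x n w)) \<theta>\<^sub>0) \<in> borel_measurable (P \<theta>\<^sub>0)) \<longrightarrow>
      argmax_exists_asymptotically (P \<theta>\<^sub>0) x h \<Theta> \<and> weakly_consistent (P \<theta>\<^sub>0) x T \<theta>\<^sub>0 \<and>
      converges_in_distribution (P \<theta>\<^sub>0) (\<lambda>n w. G n (T n (obs x n w)) \<theta>\<^sub>0) Q \<longrightarrow>
        converges_in_distribution (P \<theta>\<^sub>0) (\<lambda>n w. G n (T' n (obs x n w)) \<theta>\<^sub>0) Q)"
proof -
  have "\<theta>\<^sub>0 \<in> \<Theta>"
    using assms(1,2) interior_subset by blast
  then interpret prob_space "P \<theta>\<^sub>0"
    using assms(3) by blast
  obtain \<delta> where "\<delta> > 0" and ball: "ball \<theta>\<^sub>0 \<delta> \<subseteq> \<Theta>'"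
    using assms(2) unfolding mem_interior by blast
  define U where "U n = {w \<in> space (P \<theta>\<^sub>0). unique_argmax (h n (obs x n w)) \<Theta>}" for n
  define U' where "U' n = {w \<in> space (P \<theta>\<^sub>0). unique_argmax (h n (obs x n w)) \<Theta>'}" for n
  define C where "C \<epsilon> n = {w \<in> space (P \<theta>\<^sub>0). norm (T n (obs x n w) - \<theta>\<^sub>0) < \<epsilon>}" for \<epsilon> n
  define C' where "C' \<epsilon> n = {w \<in> space (P \<theta>\<^sub>0). norm (T' n (obs x n w) - \<theta>\<^sub>0) < \<epsilon>}" for \<epsilon> n
  define E where "E n = {w \<in> space (P \<theta>\<^sub>0). T n (obs x n w) = T' n (obs x n w)}" for n
  note defs = U_def U'_def C_def C'_def E_def
  have meas: "U n \<in> events" "U' n \<in> events" "E n \<in> events" if "n \<ge> 1" for n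
    using that assms(7,8,11) by (auto simp: defs)
  have meas_C: "C \<epsilon> n \<in> events" "C' \<epsilon> n \<in> events" if "n \<ge> 1" "\<epsilon> > 0" for n \<epsilon>
    using that assms(9,10) by (auto simp: defs)
  \<comment> \<open>The radius \<delta> is fixed here: being that close to
    \<open>\<theta>\<^sub>0\<close> places \<open>T n\<close> inside \<Theta>'. The bound
    \<open>n \<ge> 1\<close> is where the defining property of the estimators starts.\<close>
  have agree: "U n \<inter> C \<delta> n \<subseteq> U' n \<inter> E n" if "n \<ge> 1" for n
  proof
    fix w assume w: "w \<in> U n \<inter> C \<delta> n"
    then have "T n (obs x n w) \<in> \<Theta>'"
      using ball by (auto simp: C_def dist_norm norm_minus_commute)
    moreover have "obs x n w \<in> space (PiM {1..n} (\<lambda>_. X))"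
      using w \<open>\<theta>\<^sub>0 \<in> \<Theta>\<close> assms(4) by (intro obs_in_space_PiM) (auto simp: U_def)
    ultimately show "w \<in> U' n \<inter> E n"
      using argmax_estimators_agree[OF assms(5,6) that] w assms(1) by (auto simp: defs)
  qed
  have consistent: "(\<lambda>n. prob (U' n)) \<longlonglongrightarrow> 1 \<and> weakly_consistent (P \<theta>\<^sub>0) x T' \<theta>\<^sub>0 \<and> (\<lambda>n. prob (E n)) \<longlonglongrightarrow> 1"
    if U: "(\<lambda>n. prob (U n)) \<longlonglongrightarrow> 1" and T: "weakly_consistent (P \<theta>\<^sub>0) x T \<theta>\<^sub>0"
  proof (intro conjI)
    have C: "(\<lambda>n. prob (C \<epsilon> n)) \<longlonglongrightarrow> 1" if "\<epsilon> > 0" for \<epsilon>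
      using T that by (simp add: weakly_consistent_def C_def)
    \<comment> \<open>This one event drives the rest: by \<open>agree\<close> it lies in both
      \<open>U' n\<close> and \<open>E n\<close>, so both of their limits follow by
      monotonicity.\<close>
    have UC: "(\<lambda>n. prob (U n \<inter> C \<delta> n)) \<longlonglongrightarrow> 1"
      using U C[OF \<open>\<delta> > 0\<close>] meas meas_C \<open>\<delta> > 0\<close>
      by (intro prob_tendsto_1_Int eventually_sequentiallyI[of 1]) auto
    show "(\<lambda>n. prob (U' n)) \<longlonglongrightarrow> 1"
      using agree meas by (intro prob_tendsto_1_mono[OF UC] eventually_sequentiallyI[of 1]) auto
    \<comment> \<open>Established ahead of the consistency of \<open>T'\<close>, which relies on
      it.\<close>
    show E: "(\<lambda>n. prob (E n)) \<longlonglongrightarrow> 1"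
      using agree meas by (intro prob_tendsto_1_mono[OF UC] eventually_sequentiallyI[of 1]) auto
    \<comment> \<open>Now \<epsilon> is arbitrary and unrelated to \<delta>: on \<open>E n\<close>
      the estimator \<open>T'\<close> inherits the distance of \<open>T\<close> from
      \<open>\<theta>\<^sub>0\<close>, so \<open>E n \<inter> C \<epsilon> n\<close> is contained in
      \<open>C' \<epsilon> n\<close>.\<close>
    have "(\<lambda>n. prob (C' \<epsilon> n)) \<longlonglongrightarrow> 1" if "\<epsilon> > 0" for \<epsilon>
    proof (rule prob_tendsto_1_mono)
      show "(\<lambda>n. prob (E n \<inter> C \<epsilon> n)) \<longlonglongrightarrow> 1"
        using E C meas meas_C that
        by (intro prob_tendsto_1_Int eventually_sequentiallyI[of 1]) auto
      show "\<forall>\<^sub>F n in sequentially. E n \<inter> C \<epsilon> n \<subseteq> C' \<epsilon> n \<and> C' \<epsilon> n \<in> events"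
        using meas_C that by (intro eventually_sequentiallyI[of 1]) (auto simp: E_def C_def C'_def)
    qed
    then show "weakly_consistent (P \<theta>\<^sub>0) x T' \<theta>\<^sub>0"
      by (simp add: weakly_consistent_def C'_def)
  qed
  \<comment> \<open>Equal estimators give equal values of \<open>G n\<close>, so the transfer lemma
    applies with the agreement events \<open>E n\<close>; their limit is a premise here and is
    supplied by \<open>consistent\<close> at the end.\<close>
  have distribution: "converges_in_distribution (P \<theta>\<^sub>0) (\<lambda>n w. G n (T' n (obs x n w)) \<theta>\<^sub>0) Q"
    if "\<forall>n\<ge>1. (\<lambda>w. G n (T n (obs x n w)) \<theta>\<^sub>0) \<in> borel_measurable (P \<theta>\<^sub>0)"
      and "\<forall>n\<ge>1. (\<lambda>w. G n (T' n (obs x n w)) \<theta>\<^sub>0) \<in> borel_measurable (P \<theta>\<^sub>0)"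
      and "converges_in_distribution (P \<theta>\<^sub>0) (\<lambda>n w. G n (T n (obs x n w)) \<theta>\<^sub>0) Q"
      and "(\<lambda>n. prob (E n)) \<longlonglongrightarrow> 1"
    using that(1,2) meas(3)
    by (intro converges_in_distribution_eq[OF that(3) _ _ that(4)] eventually_sequentiallyI[of 1])
      (auto simp: E_def)
  show ?thesis
    using consistent distribution
    unfolding argmax_exists_asymptotically_def U_def U'_def E_def by blast
qed

end
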